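(* $$\mathsf{LLPO}<_{\mathrm W}\mathsf{LPO}\;|_{\mathrm W}\;\widehat{\mathsf{LLPO}}<_{\mathrm W}\widehat{\mathsf{LPO}}.$$ That is: $\mathsf{LLPO}\leq_{\mathrm W}\mathsf{LPO}$ and $\mathsf{LPO}\not\leq_{\mathrm W}\mathsf{LLPO}$; $\mathsf{LPO}\not\leq_{\mathrm W}\widehat{\mathsf{LLPO}}$ and $\widehat{\mathsf{LLPO}}\not\leq_{\mathrm W}\mathsf{LPO}$; $\widehat{\mathsf{LLPO}}\leq_{\mathrm W}\widehat{\mathsf{LPO}}$ and $\widehat{\mathsf{LPO}}\not\leq_{\mathrm W}\widehat{\mathsf{LLPO}}$. All the negative results (the statements with $\not\leq_{\mathrm W}$) also hold with respect to an arbitrary oracle, i.e. they remain true when the reduction functions are only required to be computable relative to some oracle (equivalently, continuous).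
   Context: A multi-valued function $f:\subseteq X\rightrightarrows Y$ between represented spaces $(X,\delta_X),(Y,\delta_Y)$ (where $\delta_X:\subseteq\mathbb{N}^{\mathbb{N}}\to X$ is a surjective partial map, similarly $\delta_Y$) has domain $\{x: f(x)\neq\emptyset\}$. A realizer of $f$ is a partial $F:\subseteq\mathbb{N}^{\mathbb{N}}\to\mathbb{N}^{\mathbb{N}}$ such that $F(p)$ is defined and $\delta_YF(p)\in f(\delta_X(p))$ whenever $\delta_X(p)\in\mathrm{dom}(f)$. $f\leq_{\mathrm W}g$ iff there are computable $H,K:\subseteq\mathbb{N}^{\mathbb{N}}\to\mathbb{N}^{\mathbb{N}}$ such that for every realizer $G$ of $g$ the function $p\mapsto H\langle p,GK(p)\rangle$ is a realizer of $f$, where $\langle\cdot,\cdot\rangle$ is a computable pairing on $\mathbb{N}^{\mathbb{N}}$. $f<_{\mathrm W}g$ means $f\leq_{\mathrm W}g$ and $g\not\leq_{\mathrm W}f$; $f\,|_{\mathrm W}\,g$ means $f\not\leq_{\mathrm W}g$ and $g\not\leq_{\mathrm W}f$. $\mathsf{LPO}:\mathbb{N}^{\mathbb{N}}\to\mathbb{N}$ is defined by $\mathsf{LPO}(p)=0$ if $p(n)=0$ for some $n$, and $\mathsf{LPO}(p)=1$ otherwise. $\mathsf{LLPO}:\subseteq\mathbb{N}^{\mathbb{N}}\rightrightarrows\mathbb{N}$ has domain $\{p: p(k)\neq0\text{ for at most one }k\}$ and values in $\{0,1\}$, with $0\in\mathsf{LLPO}(p)\iff(\forall n)\,p(2n)=0$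 and $1\in\mathsf{LLPO}(p)\iff(\forall n)\,p(2n+1)=0$. $\mathbb{N}^{\mathbb{N}}$ is represented by the identity and $\mathbb{N}$ by $\delta_{\mathbb{N}}(p)=p(0)$. For $f=\mathsf{LPO}$ or $f=\mathsf{LLPO}$, the parallelization is regarded as a map $\widehat{f}:\subseteq\mathbb{N}^{\mathbb{N}}\rightrightarrows\mathbb{N}^{\mathbb{N}}$: for $p=\langle p_0,p_1,p_2,\dots\rangle$, $\widehat{f}(p)=\{q\in\mathbb{N}^{\mathbb{N}}:(\forall k)\,q(k)\in f(p_k)\}$, defined when all $p_k\in\mathrm{dom}(f)$. Here $\langle p_0,p_1,\dots\rangle\langle k,n\rangle=p_k(n)$ with a computable bijective pairing on $\mathbb{N}$. *)

theory Defs
  imports "HOL-Analysis.Function_Topology" "HOL-Library.Nat_Bijection"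
begin

section \<open>Computability on Baire space\<close>

type_synonym baire = "nat \<Rightarrow> nat"

text \<open>Programs for partial recursive functions with an oracle from Baire space (Kleene's
  schemes), evaluated on argument lists. \<open>Oracle\<close> queries the oracle, \<open>Mu\<close> is unbounded
  minimization in the first argument, and \<open>PrimRec\<close> recurses on the first argument.\<close>

datatype recf =
    Zero
  | Succ
  | Proj nat
  | Oracle
  | Comp recf "recf list"
  | PrimRec recf recf
  | Mu recf

inductive computes :: "baire \<Rightarrow> recf \<Rightarrow> nat list \<Rightarrow> nat \<Rightarrow> bool" for p :: baire where
  Zero: "computes p Zero xs 0"
| Succ: "computes p Succ [x] (Suc x)"
| Proj: "i < length xs \<Longrightarrow> computes p (Proj i) xs (xs ! i)"
| Oracle: "computes p Oracle [x] (p x)"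
| Comp: "list_all2 (\<lambda>g v. computes p g xs v) gs vs \<Longrightarrow> computes p f vs y
    \<Longrightarrow> computes p (Comp f gs) xs y"
| PrimRec_0: "computes p f xs y \<Longrightarrow> computes p (PrimRec f g) (0 # xs) y"
| PrimRec_Suc: "computes p (PrimRec f g) (n # xs) z \<Longrightarrow> computes p g (n # z # xs) y
    \<Longrightarrow> computes p (PrimRec f g) (Suc n # xs) y"
| Mu: "computes p f (n # xs) 0 \<Longrightarrow> (\<forall>m<n. \<exists>v. v \<noteq> 0 \<and> computes p f (m # xs) v)
    \<Longrightarrow> computes p (Mu f) xs n"

definition pair_baire :: "baire \<Rightarrow> baire \<Rightarrow> baire" (\<open>\<langle>_,/ _\<rangle>\<close>) where
  "\<langle>p, q\<rangle> = (\<lambda>n. if even n then p (n div 2) else q (n div 2))"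

text \<open>As usual, a machine computing a partial function is only required to be correct on the
  domain of the function; since every extension of a reduction function is again a
  reduction function, this does not affect Weihrauch reducibility.\<close>

definition computable :: "(baire \<rightharpoonup> baire) \<Rightarrow> bool" where
  "computable F \<longleftrightarrow> (\<exists>e. \<forall>p q. F p = Some q \<longrightarrow> (\<forall>n. computes p e [n] (q n)))"

definition computable_relative_to :: "baire \<Rightarrow> (baire \<rightharpoonup> baire) \<Rightarrow> bool" where
  "computable_relative_to r F \<longleftrightarrow>
     (\<exists>e. \<forall>p q. F p = Some q \<longrightarrow> (\<forall>n. computes \<langle>r, p\<rangle> e [n] (q n)))"

definition oracle_computable :: "(baire \<rightharpoonup> baire) \<Rightarrow> bool" where
  "oracle_computable F \<longleftrightarrow> (\<exists>r. computable_relative_to r F)"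

text \<open>The type \<^typ>\<open>nat \<Rightarrow> nat\<close> carries the product topology of the discrete topology.\<close>

definition partial_continuous :: "(baire \<rightharpoonup> baire) \<Rightarrow> bool" where
  "partial_continuous F \<longleftrightarrow> continuous_on (dom F) (\<lambda>p. the (F p))"


section \<open>Weihrauch reducibility\<close>

text \<open>A multi-valued function between represented spaces. A representation is a partial map
  from Baire space; the space it represents is its range, so it is surjective by convention.
  The value set of a point outside the domain of a multi-valued function is empty.\<close>

record ('a, 'b) problem =
  src_rep :: "baire \<rightharpoonup> 'a"
  tgt_rep :: "baire \<rightharpoonup> 'b"
  vals :: "'a \<Rightarrow> 'b set"

definition mdom :: "('a, 'b) problem \<Rightarrow> 'a set" where
  "mdom f = {x. vals f x \<noteq> {}}"

definition realizer :: "('a, 'b) problem \<Rightarrow> (baire \<rightharpoonup> baire) \<Rightarrow> bool" where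
  "realizer f F \<longleftrightarrow>
     (\<forall>p x. src_rep f p = Some x \<and> x \<in> mdom f \<longrightarrow>
        (\<exists>q y. F p = Some q \<and> tgt_rep f q = Some y \<and> y \<in> vals f x))"

text \<open>Reducibility with reduction functions from the class \<open>\<C>\<close>; the composition
  \<open>p \<mapsto> H\<langle>p, GK(p)\<rangle>\<close> is undefined as soon as one of its parts is.\<close>

definition reducible_via ::
  "((baire \<rightharpoonup> baire) \<Rightarrow> bool) \<Rightarrow> ('a, 'b) problem \<Rightarrow> ('c, 'd) problem \<Rightarrow> bool" where
  "reducible_via \<C> f g \<longleftrightarrow>
     (\<exists>H K. \<C> H \<and> \<C> K \<and>
        (\<forall>G. realizer g G \<longrightarrow>
           realizer f (\<lambda>p. Option.bind ((G \<circ>\<^sub>m K) p) (\<lambda>q. H \<langle>p, q\<rangle>))))"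

definition weihrauch_le :: "('a, 'b) problem \<Rightarrow> ('c, 'd) problem \<Rightarrow> bool"
    (infix \<open>\<le>\<^sub>W\<close> 50) where
  "f \<le>\<^sub>W g \<longleftrightarrow> reducible_via computable f g"

definition weihrauch_less :: "('a, 'b) problem \<Rightarrow> ('c, 'd) problem \<Rightarrow> bool"
    (infix \<open><\<^sub>W\<close> 50) where
  "f <\<^sub>W g \<longleftrightarrow> f \<le>\<^sub>W g \<and> \<not> g \<le>\<^sub>W f"

definition weihrauch_incomparable :: "('a, 'b) problem \<Rightarrow> ('c, 'd) problem \<Rightarrow> bool"
    (infix \<open>\<bar>\<^sub>W\<close> 50) where
  "f \<bar>\<^sub>W g \<longleftrightarrow> \<not> f \<le>\<^sub>W g \<and> \<not> g \<le>\<^sub>W f"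


section \<open>LPO, LLPO and their parallelizations\<close>

definition rep_baire :: "baire \<rightharpoonup> baire" where
  "rep_baire p = Some p"

definition rep_nat :: "baire \<rightharpoonup> nat" where
  "rep_nat p = Some (p 0)"

definition LPO :: "(baire, nat) problem" where
  "LPO = \<lparr>src_rep = rep_baire, tgt_rep = rep_nat,
          vals = (\<lambda>p. {if \<exists>n. p n = 0 then 0 else 1})\<rparr>"

definition LLPO :: "(baire, nat) problem" where
  "LLPO = \<lparr>src_rep = rep_baire, tgt_rep = rep_nat,
           vals = (\<lambda>p. {i. (\<forall>k l. p k \<noteq> 0 \<and> p l \<noteq> 0 \<longrightarrow> k = l) \<and>
                          (i = 0 \<and> (\<forall>n. p (2 * n) = 0) \<or>
                           i = 1 \<and> (\<forall>n. p (2 * n + 1) = 0))})\<rparr>"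

text \<open>\<open>component p k\<close> is the \<open>k\<close>-th entry \<open>p\<^sub>k\<close> of \<open>p = \<langle>p\<^sub>0, p\<^sub>1, \<dots>\<rangle>\<close>.\<close>

definition component :: "baire \<Rightarrow> nat \<Rightarrow> baire" where
  "component p k = (\<lambda>n. p (prod_encode (k, n)))"

definition parallelization :: "(baire, nat) problem \<Rightarrow> (baire, baire) problem" where
  "parallelization f = \<lparr>src_rep = rep_baire, tgt_rep = rep_baire,
     vals = (\<lambda>p. {q. \<forall>k. q k \<in> vals f (component p k)})\<rparr>"

lemma ran_rep_baire: "ran rep_baire = UNIV"
  by (auto simp: ran_def rep_baire_def)

lemma ran_rep_nat: "ran rep_nat = UNIV"
proof -
  have "rep_nat (\<lambda>_. x) = Some x" for x
    by (simp add: rep_nat_def)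
  then show ?thesis
    by (auto simp: ran_def)
qed

lemma mdom_LPO: "mdom LPO = UNIV"
  by (auto simp: mdom_def LPO_def)

lemma mdom_LLPO: "mdom LLPO = {p. \<forall>k l. p k \<noteq> 0 \<and> p l \<noteq> 0 \<longrightarrow> k = l}"
proof (intro equalityI subsetI)
  fix p assume "p \<in> {p :: baire. \<forall>k l. p k \<noteq> 0 \<and> p l \<noteq> 0 \<longrightarrow> k = l}"
  then have *: "\<forall>k l. p k \<noteq> 0 \<and> p l \<noteq> 0 \<longrightarrow> k = l"
    by (rule CollectD)
  show "p \<in> mdom LLPO"
  proof (cases "\<forall>n. p (2 * n) = 0")
    case True
    with * have "0 \<in> vals LLPO p"
      unfolding LLPO_def problem.simps by blast
    then show ?thesis
      unfolding mdom_def by blast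
  next
    case False
    then obtain m where m: "p (2 * m) \<noteq> 0"
      by blast
    have "p (2 * n + 1) = 0" for n
    proof (rule ccontr)
      assume "p (2 * n + 1) \<noteq> 0"
      with m * have "2 * m = 2 * n + 1"
        by blast
      then show False
        by presburger
    qed
    with * have "1 \<in> vals LLPO p"
      unfolding LLPO_def problem.simps by blast
    then show ?thesis
      unfolding mdom_def by blast
  qed
next
  fix p assume "p \<in> mdom LLPO"
  then show "p \<in> {p. \<forall>k l. p k \<noteq> 0 \<and> p l \<noteq> 0 \<longrightarrow> k = l}"
    unfolding mdom_def LLPO_def problem.simps by blast
qed

lemma mdom_parallelization:
  "mdom (parallelization f) = {p. \<forall>k. component p k \<in> mdom f}"
proof -
  have "(\<exists>q. \<forall>k. q k \<in> vals f (component p k)) \<longleftrightarrow> (\<forall>k. \<exists>y. y \<in> vals f (component p k))" for p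
    by metis
  then show ?thesis
    by (auto simp: mdom_def parallelization_def)
qed

end

theory Submission imports Defs begin

text \<open>Both positive reductions rest on one observation: an admissible \<open>x\<close> has all its even
  digits equal to zero iff the sequence \<open>n \<mapsto> 1 - x (2 * n)\<close> has no zero, so the negated answer
  of LPO on this sequence is a correct answer of LLPO on \<open>x\<close> (\<open>LLPO_from_LPO_of_even_digits\<close>).
  This can be done in all components at once. What remains is to write down programs; the one
  that needs work turns the code of \<open>(k, n)\<close> into the code of \<open>(k, 2 * n)\<close>.

  All negative results are topological. A halting computation queries its oracle finitely often,
  so computable functions, with or without an additional oracle, are continuous, and it suffices
  to exclude continuous reductions.

  LPO and its parallelization do not reduce to LLPO or its parallelization because of
  compactness. Solutions of the latter may be chosen in Cantor space and the solution relation
  is closed, so along a convergent sequence of instances some solutions have a subsequence that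
  converges to a solution of the limit. A continuous reduction carries this property over to the
  reduced problem. But LPO lacks it: sequences with a single zero, moving to infinity, have
  answer 0 and converge to a sequence with answer 1
  (\<open>discontinuous_not_reducible_to_compactly_solvable\<close>).

  The parallelization of LLPO does not reduce to LPO because a single bit is not enough. Around
  an instance \<open>x\<close> with a zero component no continuous function solves the problem: putting a 1 far
  out at an even or at an odd place of that component forces different answers, both of which
  would have to be the answer at \<open>x\<close> (\<open>no_continuous_solution_near_zero_component\<close>). Suppose
  that \<open>K\<close> and \<open>H\<close> witness a reduction. If \<open>K x\<close> had a zero, then so would \<open>K x'\<close> for all \<open>x'\<close>
  near \<open>x\<close>, and \<open>H\<close> with the fixed LPO answer 0 would be a continuous solution near \<open>x\<close>. So LPO
  answers 1 on every instance with a zero component. The zero instance and its perturbations in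
  component 0 all have such a component, namely component 1, so \<open>H\<close> with the fixed answer 1 is a
  continuous solution near the zero instance: a contradiction again.\<close>

section \<open>Sequences in Baire space\<close>

lemma tendsto_baire_iff:
  fixes X :: "'a \<Rightarrow> baire"
  shows "(X \<longlongrightarrow> x) F \<longleftrightarrow> (\<forall>i. \<forall>\<^sub>F t in F. X t i = x i)"
proof -
  have "(X \<longlongrightarrow> x) F \<longleftrightarrow> limitin (product_topology (\<lambda>_. euclidean) UNIV) X x F"
    by (simp add: euclidean_product_topology)
  also have "\<dots> \<longleftrightarrow> (\<forall>i. ((\<lambda>t. X t i) \<longlongrightarrow> x i) F)"
    by (subst limitin_componentwise) simp
  also have "\<dots> \<longleftrightarrow> (\<forall>i. \<forall>\<^sub>F t in F. X t i = x i)"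
    by (simp add: nhds_discrete filterlim_principal)
  finally show ?thesis .
qed

lemma tendsto_pair_baire:
  assumes "(X \<longlongrightarrow> x) F" "(Y \<longlongrightarrow> y) F"
  shows "((\<lambda>t. \<langle>X t, Y t\<rangle>) \<longlongrightarrow> \<langle>x, y\<rangle>) F"
  using assms by (auto simp: tendsto_baire_iff pair_baire_def)

lemma tendsto_component:
  assumes "(X \<longlongrightarrow> x) F"
  shows "((\<lambda>t. component (X t) k) \<longlongrightarrow> component x k) F"
  using assms by (auto simp: tendsto_baire_iff component_def)

lemma tendsto_fun_upd:
  assumes "inj h"
  shows "(\<lambda>n. x(h n := c)) \<longlonglongrightarrow> (x :: baire)"
  unfolding tendsto_baire_iff
proof
  fix i
  have "finite {n. h n = i}"
    using assms by (intro finite_subset[OF _ finite.insertI[OF finite.emptyI, of "inv h i"]])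
      (auto simp: inv_f_f)
  then have "\<forall>\<^sub>F n in sequentially. h n \<noteq> i"
    by (simp add: eventually_cofinite flip: cofinite_eq_sequentially)
  then show "\<forall>\<^sub>F n in sequentially. (x(h n := c)) i = x i"
    by eventually_elim simp
qed

lemma partial_continuous_tendsto:
  assumes "partial_continuous F" and "(X \<longlongrightarrow> x) A" and "F x = Some y"
    and "\<forall>\<^sub>F t in A. F (X t) = Some (Y t)"
  shows "(Y \<longlongrightarrow> y) A"
proof -
  have "\<forall>\<^sub>F t in A. X t \<in> dom F"
    using assms(4) by eventually_elim auto
  then have "((\<lambda>t. the (F (X t))) \<longlongrightarrow> the (F x)) A"
    using assms(1-3) unfolding partial_continuous_def
    by (intro continuous_on_tendsto_compose[of "dom F" "\<lambda>p. the (F p)"]) auto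
  moreover have "\<forall>\<^sub>F t in A. the (F (X t)) = Y t"
    using assms(4) by eventually_elim simp
  ultimately show ?thesis
    using assms(3) by (simp add: tendsto_cong)
qed

lemma cantor_convergent_subsequence:
  fixes Q :: "nat \<Rightarrow> baire"
  assumes "\<And>n i. Q n i \<in> {0, 1}"
  obtains q r where "strict_mono r" "(Q \<circ> r) \<longlonglongrightarrow> q"
proof -
  have "compactin (product_topology (\<lambda>_. euclidean) UNIV) (PiE UNIV (\<lambda>_::nat. {0, 1::nat}))"
    by (subst compactin_PiE) (auto intro: finite_imp_compact)
  then have "seq_compact (PiE UNIV (\<lambda>_::nat. {0, 1::nat}))"
    by (intro compact_imp_seq_compact) (simp add: euclidean_product_topology)
  moreover have "\<forall>n. Q n \<in> PiE UNIV (\<lambda>_. {0, 1})"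
    using assms by (auto simp: PiE_UNIV_domain)
  ultimately show ?thesis
    using that by (metis seq_compactE)
qed

section \<open>Computable functions are continuous\<close>

lemma computes_deterministic:
  "computes p e xs y \<Longrightarrow> computes p e xs z \<Longrightarrow> y = z"
proof (induction arbitrary: z rule: computes.induct)
  case (Comp xs gs vs f y)
  from Comp.prems obtain ws where
    "list_all2 (\<lambda>g v. computes p g xs v) gs ws" and f: "computes p f ws z"
    by (cases rule: computes.cases) auto
  moreover from Comp.IH(1) this(1) have "vs = ws"
  proof (induction arbitrary: ws rule: list_all2_induct)
    case Nil
    then show ?case by simp
  next
    case (Cons g gs v vs)
    then show ?case by (cases ws) auto
  qed
  ultimately show ?case
    using Comp.IH(2) by simp
next
  case (PrimRec_0 f xs y g)
  from PrimRec_0.prems show ?case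
    by (cases rule: computes.cases) (auto intro: PrimRec_0.IH)
next
  case (PrimRec_Suc f g n xs w y)
  from PrimRec_Suc.prems obtain w' where
    "computes p (PrimRec f g) (n # xs) w'" "computes p g (n # w' # xs) z"
    by (cases rule: computes.cases) auto
  with PrimRec_Suc.IH show ?case
    by blast
next
  case (Mu f n xs)
  from Mu.prems have z: "computes p f (z # xs) 0"
    "\<forall>m<z. \<exists>v. v \<noteq> 0 \<and> computes p f (m # xs) v"
    by (cases rule: computes.cases; auto)+
  show ?case
  proof (rule linorder_cases[of n z])
    assume "n < z"
    with z(2) Mu.IH(1) show ?thesis by blast
  next
    assume "z < n"
    with z(1) Mu.IH(2) show ?thesis by blast
  qed
qed (auto elim: computes.cases)

text \<open>The use principle in terms of filters: only finitely many oracle values enter a halting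
  computation, so it is also a computation for all oracles that are close enough. In the case of
  minimization finiteness is that of the set of arguments below the result.\<close>

lemma computes_eventually:
  assumes "computes p e xs y" and P: "(P \<longlongrightarrow> p) A"
  shows "\<forall>\<^sub>F t in A. computes (P t) e xs y"
  using assms(1)
proof (induction rule: computes.induct)
  case (Oracle x)
  have "\<forall>\<^sub>F t in A. P t x = p x"
    using P by (simp add: tendsto_baire_iff)
  then show ?case
    by eventually_elim (metis computes.Oracle)
next
  case (Comp xs gs vs f y)
  from Comp.IH(1) have "\<forall>\<^sub>F t in A. list_all2 (\<lambda>g v. computes (P t) g xs v) gs vs"
  proof (induction rule: list_all2_induct)
    case (Cons g gs v vs)
    then have "\<forall>\<^sub>F t in A. computes (P t) g xs v" by simp
    with Cons.IH show ?case
      by eventually_elim simp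
  qed simp
  with Comp.IH(2) show ?case
    by eventually_elim (rule computes.Comp)
next
  case (PrimRec_0 f xs y g)
  from PrimRec_0.IH show ?case
    by eventually_elim (rule computes.PrimRec_0)
next
  case (PrimRec_Suc f g n xs z y)
  from PrimRec_Suc.IH show ?case
    by eventually_elim (rule computes.PrimRec_Suc)
next
  case (Mu f n xs)
  have "\<forall>\<^sub>F t in A. \<forall>m\<in>{..<n}. \<exists>v. v \<noteq> 0 \<and> computes (P t) f (m # xs) v"
  proof (intro eventually_ball_finite ballI)
    fix m assume "m \<in> {..<n}"
    with Mu.IH(2) obtain v where "v \<noteq> 0" "\<forall>\<^sub>F t in A. computes (P t) f (m # xs) v"
      by auto
    from this(2) show "\<forall>\<^sub>F t in A. \<exists>v. v \<noteq> 0 \<and> computes (P t) f (m # xs) v"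
      by eventually_elim (use \<open>v \<noteq> 0\<close> in auto)
  qed simp
  with Mu.IH(1) show ?case
    by eventually_elim (auto intro: computes.Mu)
qed (auto intro: always_eventually computes.intros)

text \<open>The parameter \<open>R\<close> is what the machine gets as its oracle: the argument itself, or the
  argument paired with a fixed sequence.\<close>

lemma program_imp_partial_continuous:
  assumes e: "\<And>p q n. F p = Some q \<Longrightarrow> computes (R p) e [n] (q n)"
    and R: "\<And>p S. (R \<longlongrightarrow> R p) (at p within S)"
  shows "partial_continuous F"
  unfolding partial_continuous_def continuous_on_def tendsto_baire_iff
proof (intro ballI allI)
  fix p n
  assume "p \<in> dom F"
  then have "computes (R p) e [n] (the (F p) n)"
    using e by auto
  then have "\<forall>\<^sub>F t in at p within dom F. computes (R t) e [n] (the (F p) n)"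
    using R by (rule computes_eventually)
  moreover have "\<forall>\<^sub>F t in at p within dom F. t \<in> dom F"
    by (simp add: eventually_at_filter)
  ultimately show "\<forall>\<^sub>F t in at p within dom F. the (F t) n = the (F p) n"
  proof eventually_elim
    case (elim t)
    then obtain q where "F t = Some q"
      by auto
    with e[OF this, of n] elim(1) show ?case
      by (auto dest: computes_deterministic)
  qed
qed

lemma computable_imp_partial_continuous:
  assumes "computable F"
  shows "partial_continuous F"
proof -
  from assms obtain e where e: "\<And>p q n. F p = Some q \<Longrightarrow> computes p e [n] (q n)"
    unfolding computable_def by blast
  show ?thesis
    by (rule program_imp_partial_continuous[where R = "\<lambda>p. p" and e = e])
      (erule e, rule tendsto_ident_at)
qed

lemma oracle_computable_imp_partial_continuous:
  assumes "oracle_computable F"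
  shows "partial_continuous F"
proof -
  from assms obtain r e where e: "\<And>p q n. F p = Some q \<Longrightarrow> computes \<langle>r, p\<rangle> e [n] (q n)"
    unfolding oracle_computable_def computable_relative_to_def by blast
  show ?thesis
    by (rule program_imp_partial_continuous[where R = "\<lambda>p. \<langle>r, p\<rangle>" and e = e])
      (erule e, intro tendsto_pair_baire tendsto_const tendsto_ident_at)
qed

section \<open>Weihrauch reductions without realizers\<close>

text \<open>The following two notions transfer a problem to names in Baire space, so that reductions
  can be discussed without mentioning the represented spaces.\<close>

definition is_instance :: "('a, 'b) problem \<Rightarrow> baire \<Rightarrow> bool" where
  "is_instance f p \<longleftrightarrow> (\<exists>x. src_rep f p = Some x \<and> x \<in> mdom f)"

definition solves :: "('a, 'b) problem \<Rightarrow> baire \<Rightarrow> baire \<Rightarrow> bool" where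
  "solves f p s \<longleftrightarrow> (\<exists>x y. src_rep f p = Some x \<and> tgt_rep f s = Some y \<and> y \<in> vals f x)"

lemma realizer_iff_solves:
  "realizer f F \<longleftrightarrow> (\<forall>p. is_instance f p \<longrightarrow> (\<exists>s. F p = Some s \<and> solves f p s))"
  unfolding realizer_def is_instance_def solves_def by fastforce

lemma is_instance_imp_solution:
  assumes "ran (tgt_rep f) = UNIV" and "is_instance f p"
  shows "\<exists>s. solves f p s"
proof -
  from assms(2) obtain x y where "src_rep f p = Some x" "y \<in> vals f x"
    unfolding is_instance_def mdom_def by blast
  moreover have "y \<in> ran (tgt_rep f)"
    using assms(1) by simp
  ultimately show ?thesis
    unfolding ran_def solves_def by blast
qed

text \<open>The quantification over realizers of \<open>g\<close> can be eliminated, because a realizer may take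
  any solution as its value at a given instance \<open>k\<close>, and may be undefined on everything that is
  not an instance. The surjectivity hypothesis ensures that every instance has a solution
  with a name, so that there are realizers to vary.\<close>

lemma reducible_via_iff_solves:
  assumes surj: "ran (tgt_rep g) = UNIV"
  shows "reducible_via \<C> f g \<longleftrightarrow>
    (\<exists>H K. \<C> H \<and> \<C> K \<and>
      (\<forall>p. is_instance f p \<longrightarrow>
        (\<exists>k. K p = Some k \<and> is_instance g k \<and>
          (\<forall>q. solves g k q \<longrightarrow> (\<exists>s. H \<langle>p, q\<rangle> = Some s \<and> solves f p s)))))"
    (is "_ \<longleftrightarrow> (\<exists>H K. _ H \<and> _ K \<and> ?red H K)")
proof -
  have "(\<forall>G. realizer g G \<longrightarrow>
           realizer f (\<lambda>p. Option.bind ((G \<circ>\<^sub>m K) p) (\<lambda>q. H \<langle>p, q\<rangle>))) \<longleftrightarrow> ?red H K" for H K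
  proof (intro iffI allI impI)
    fix p
    assume red: "\<forall>G. realizer g G \<longrightarrow>
        realizer f (\<lambda>p. Option.bind ((G \<circ>\<^sub>m K) p) (\<lambda>q. H \<langle>p, q\<rangle>))"
      and p: "is_instance f p"
    define sol where "sol k = (SOME s. solves g k s)" for k
    have sol: "solves g k (sol k)" if "is_instance g k" for k
      unfolding sol_def using is_instance_imp_solution[OF surj that] by (rule someI_ex)
    define G where "G = (\<lambda>k. if is_instance g k then Some (sol k) else None)"
    have G: "realizer g (\<lambda>k'. if k' = k then Some q else G k')"
      if "is_instance g k \<Longrightarrow> solves g k q" for k q
      using that sol by (auto simp: realizer_iff_solves G_def)
    have "realizer g G"
      using sol by (simp add: realizer_iff_solves G_def)
    with red p have "Option.bind ((G \<circ>\<^sub>m K) p) (\<lambda>q. H \<langle>p, q\<rangle>) \<noteq> None"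
      unfolding realizer_iff_solves by fastforce
    then obtain k where k: "K p = Some k" "is_instance g k"
      by (auto simp: map_comp_def G_def split: option.splits if_splits)
    moreover have "\<exists>s. H \<langle>p, q\<rangle> = Some s \<and> solves f p s" if "solves g k q" for q
      using red[rule_format, OF G[of k q]] that p k(1)
      by (auto simp: realizer_iff_solves map_comp_def)
    ultimately show "\<exists>k. K p = Some k \<and> is_instance g k \<and>
        (\<forall>q. solves g k q \<longrightarrow> (\<exists>s. H \<langle>p, q\<rangle> = Some s \<and> solves f p s))"
      by blast
  next
    fix G
    assume red: "?red H K" and "realizer g G"
    then show "realizer f (\<lambda>p. Option.bind ((G \<circ>\<^sub>m K) p) (\<lambda>q. H \<langle>p, q\<rangle>))"
      unfolding realizer_iff_solves map_comp_def by fastforce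
  qed
  then show ?thesis
    unfolding reducible_via_def by simp
qed

lemma reducible_via_mono:
  assumes "reducible_via \<C> f g" and "\<And>F. \<C> F \<Longrightarrow> \<D> F"
  shows "reducible_via \<D> f g"
  using assms unfolding reducible_via_def by blast

section \<open>Instances and solutions of LPO, LLPO and their parallelizations\<close>

lemma is_instance_LPO: "is_instance LPO p"
  by (simp add: is_instance_def mdom_LPO) (simp add: LPO_def rep_baire_def)

lemma solves_LPO: "solves LPO p s \<longleftrightarrow> s 0 \<in> vals LPO p"
  by (auto simp: solves_def LPO_def rep_baire_def rep_nat_def)

lemma is_instance_LLPO: "is_instance LLPO p \<longleftrightarrow> p \<in> mdom LLPO"
  by (simp add: is_instance_def) (simp add: LLPO_def rep_baire_def)

lemma solves_LLPO: "solves LLPO p s \<longleftrightarrow> s 0 \<in> vals LLPO p"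
  by (auto simp: solves_def LLPO_def rep_baire_def rep_nat_def)

lemma is_instance_parallelization:
  "is_instance (parallelization f) p \<longleftrightarrow> (\<forall>k. component p k \<in> mdom f)"
  by (simp add: is_instance_def mdom_parallelization)
    (simp add: parallelization_def rep_baire_def)

lemma solves_parallelization:
  "solves (parallelization f) p s \<longleftrightarrow> (\<forall>k. s k \<in> vals f (component p k))"
  by (auto simp: solves_def parallelization_def rep_baire_def)

lemma vals_LPO: "vals LPO p = {if \<exists>n. p n = 0 then 0 else 1}"
  by (simp add: LPO_def)

lemma vals_LPO_zero: "p n = 0 \<Longrightarrow> vals LPO p = {0}"
  by (auto simp: vals_LPO)

lemma vals_LPO_nonzero: "(\<And>n. p n \<noteq> 0) \<Longrightarrow> vals LPO p = {1}"
  by (simp add: vals_LPO)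

lemma ran_tgt_rep:
  "ran (tgt_rep LPO) = UNIV" "ran (tgt_rep LLPO) = UNIV"
  "ran (tgt_rep (parallelization f)) = UNIV"
  by (simp_all add: LPO_def LLPO_def parallelization_def ran_rep_nat ran_rep_baire)

lemma in_vals_LLPO_iff:
  "i \<in> vals LLPO x \<longleftrightarrow>
    x \<in> mdom LLPO \<and> (i = 0 \<and> (\<forall>n. x (2 * n) = 0) \<or> i = 1 \<and> (\<forall>n. x (2 * n + 1) = 0))"
  by (simp only: mdom_LLPO) (simp add: LLPO_def)

lemma vals_LLPO_subset: "vals LLPO p \<subseteq> {0, 1}"
  by (auto simp: LLPO_def)

lemma mdom_iff_vals: "x \<in> mdom f \<longleftrightarrow> (\<exists>y. y \<in> vals f x)"
  by (auto simp: mdom_def)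

section \<open>LPO does not reduce to compact choice\<close>

text \<open>The sequential form of the compactness property of LLPO that LPO lacks; by
  \<open>compactly_solvableI\<close> it follows if every instance has a solution in Cantor space and the
  solution relation is closed.\<close>

definition compactly_solvable :: "('a, 'b) problem \<Rightarrow> bool" where
  "compactly_solvable g \<longleftrightarrow>
     (\<forall>X x. (\<forall>n. is_instance g (X n)) \<and> X \<longlonglongrightarrow> x \<longrightarrow>
       (\<exists>Q q r. strict_mono r \<and> (\<forall>n. solves g (X n) (Q n)) \<and>
          (Q \<circ> r) \<longlonglongrightarrow> q \<and> solves g x q))"

lemma compactly_solvableI:
  assumes bounded: "\<And>p. is_instance g p \<Longrightarrow> \<exists>s. solves g p s \<and> (\<forall>i. s i \<in> {0, 1})"
    and closed: "\<And>X x Q q. X \<longlonglongrightarrow> x \<Longrightarrow> Q \<longlonglongrightarrow> q \<Longrightarrow>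
      (\<And>n. solves g (X n) (Q n)) \<Longrightarrow> solves g x q"
  shows "compactly_solvable g"
  unfolding compactly_solvable_def
proof (intro allI impI)
  fix X x
  assume X: "(\<forall>n. is_instance g (X n)) \<and> X \<longlonglongrightarrow> x"
  then have "\<forall>n. \<exists>s. solves g (X n) s \<and> (\<forall>i. s i \<in> {0, 1})"
    using bounded by blast
  then obtain Q where "\<forall>n. solves g (X n) (Q n) \<and> (\<forall>i. Q n i \<in> {0, 1})"
    by (rule choice[THEN exE])
  then have Q: "\<And>n. solves g (X n) (Q n)" "\<And>n i. Q n i \<in> {0, 1}"
    by blast+
  from cantor_convergent_subsequence[of Q, OF Q(2)] obtain r q where
    r: "strict_mono r" and q: "(Q \<circ> r) \<longlonglongrightarrow> q" by blast
  have "(X \<circ> r) \<longlonglongrightarrow> x"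
    using X r by (intro LIMSEQ_subseq_LIMSEQ) auto
  then have "solves g x q"
    using q Q(1) by (intro closed[of "X \<circ> r" x "Q \<circ> r"]) auto
  with Q(1) r q show "\<exists>Q q r. strict_mono r \<and> (\<forall>n. solves g (X n) (Q n)) \<and>
          (Q \<circ> r) \<longlonglongrightarrow> q \<and> solves g x q"
    by blast
qed

text \<open>Membership in \<^term>\<open>vals LLPO x\<close> is a universal statement whose instances involve at most
  two digits of \<open>x\<close>, and two digits of a limit are already correct late in the sequence.\<close>

lemma vals_LLPO_closed:
  assumes "X \<longlonglongrightarrow> x" and "\<And>n. i n \<in> vals LLPO (X n)"
    and "\<forall>\<^sub>F n in sequentially. i n = j"
  shows "j \<in> vals LLPO x"
proof -
  have ev: "\<forall>\<^sub>F n in sequentially. X n k = x k" for k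
    using assms(1) by (simp add: tendsto_baire_iff)
  have two_digits: "\<exists>n. X n k = x k \<and> X n l = x l \<and> i n = j" for k l
  proof -
    have "\<forall>\<^sub>F n in sequentially. X n k = x k \<and> X n l = x l \<and> i n = j"
      using ev assms(3) by (simp add: eventually_conj_iff)
    then show ?thesis
      by (auto simp: eventually_sequentially)
  qed
  have val: "(\<forall>k l. X n k \<noteq> 0 \<and> X n l \<noteq> 0 \<longrightarrow> k = l) \<and>
      (i n = 0 \<and> (\<forall>m. X n (2 * m) = 0) \<or> i n = 1 \<and> (\<forall>m. X n (2 * m + 1) = 0))" for n
    using assms(2)[of n] unfolding LLPO_def problem.simps by blast
  have "\<forall>k l. x k \<noteq> 0 \<and> x l \<noteq> 0 \<longrightarrow> k = l"
    using two_digits val by metis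
  moreover have "j = 0 \<or> j = 1"
    using two_digits val by metis
  moreover have "x (2 * m) = 0" if "j = 0" for m
    using two_digits val that by (metis zero_neq_one)
  moreover have "x (2 * m + 1) = 0" if "j = 1" for m
    using two_digits val that by (metis zero_neq_one)
  ultimately show ?thesis
    unfolding LLPO_def problem.simps by blast
qed

lemma compactly_solvable_LLPO: "compactly_solvable LLPO"
proof (rule compactly_solvableI)
  fix p
  assume "is_instance LLPO p"
  then obtain i where "i \<in> vals LLPO p"
    by (auto simp: is_instance_LLPO mdom_iff_vals)
  then show "\<exists>s. solves LLPO p s \<and> (\<forall>i. s i \<in> {0, 1})"
    using vals_LLPO_subset[of p] by (intro exI[of _ "\<lambda>_. i"]) (auto simp: solves_LLPO)
next
  fix X x Q q
  assume "X \<longlonglongrightarrow> x" "Q \<longlonglongrightarrow> q" "\<And>n. solves LLPO (X n) (Q n)"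
  then show "solves LLPO x q"
    unfolding solves_LLPO
    by (intro vals_LLPO_closed[of X x "\<lambda>n. Q n 0"]) (auto simp: tendsto_baire_iff)
qed

lemma compactly_solvable_parallelization_LLPO:
  "compactly_solvable (parallelization LLPO)"
proof (rule compactly_solvableI)
  fix p
  assume "is_instance (parallelization LLPO) p"
  then obtain s where "\<And>k. s k \<in> vals LLPO (component p k)"
    by (auto simp: is_instance_parallelization mdom_iff_vals) metis
  then show "\<exists>s. solves (parallelization LLPO) p s \<and> (\<forall>i. s i \<in> {0, 1})"
    using vals_LLPO_subset by (auto simp: solves_parallelization)
next
  fix X x Q q
  assume lim: "X \<longlonglongrightarrow> x" "Q \<longlonglongrightarrow> q"
    and sol: "\<And>n. solves (parallelization LLPO) (X n) (Q n)"
  have "q k \<in> vals LLPO (component x k)" for k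
    using tendsto_component[OF lim(1), of k]
  proof (rule vals_LLPO_closed)
    show "Q n k \<in> vals LLPO (component (X n) k)" for n
      using sol by (simp add: solves_parallelization)
    show "\<forall>\<^sub>F n in sequentially. Q n k = q k"
      using lim(2) by (simp add: tendsto_baire_iff)
  qed
  then show "solves (parallelization LLPO) x q"
    by (simp add: solves_parallelization)
qed

text \<open>Let the queries \<open>Y n\<close> of the reduction converge to the query \<open>y\<close>, and let
  solutions of \<open>Y n\<close> converge, along a subsequence, to a solution of \<open>y\<close>. Then the answers of the
  reduction on \<open>X n\<close> converge along the same subsequence to its answer on \<open>x\<close>, whereas their first
  digits do not.\<close>

lemma discontinuous_not_reducible_to_compactly_solvable:
  assumes g: "ran (tgt_rep g) = UNIV" "compactly_solvable g"
    and X: "X \<longlonglongrightarrow> x" "\<And>n. is_instance f (X n)" "is_instance f x"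
    and jump: "\<And>n s. solves f (X n) s \<Longrightarrow> s 0 = 0" "\<And>s. solves f x s \<Longrightarrow> s 0 = 1"
  shows "\<not> reducible_via partial_continuous f g"
proof
  assume "reducible_via partial_continuous f g"
  then obtain H K where H: "partial_continuous H" and K: "partial_continuous K"
    and red: "\<And>p. is_instance f p \<Longrightarrow>
        (\<exists>k. K p = Some k \<and> is_instance g k \<and>
          (\<forall>q. solves g k q \<longrightarrow> (\<exists>s. H \<langle>p, q\<rangle> = Some s \<and> solves f p s)))"
    unfolding reducible_via_iff_solves[OF g(1)] by blast
  from red[OF X(2)] obtain Y where Y: "\<And>n. K (X n) = Some (Y n)" "\<And>n. is_instance g (Y n)"
    and HY: "\<And>n q. solves g (Y n) q \<Longrightarrow> \<exists>s. H \<langle>X n, q\<rangle> = Some s \<and> solves f (X n) s"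
    by metis
  from red[OF X(3)] obtain y where y: "K x = Some y" "is_instance g y"
    and Hy: "\<And>q. solves g y q \<Longrightarrow> \<exists>s. H \<langle>x, q\<rangle> = Some s \<and> solves f x s"
    by metis
  have "Y \<longlonglongrightarrow> y"
    using partial_continuous_tendsto[OF K X(1) y(1)] Y(1) by simp
  with g(2) Y(2) obtain Q q r where r: "strict_mono r" and Q: "\<And>n. solves g (Y n) (Q n)"
    and lim: "(Q \<circ> r) \<longlonglongrightarrow> q" and q: "solves g y q"
    unfolding compactly_solvable_def by metis
  from HY[OF Q] obtain S where S: "\<And>n. H \<langle>X n, Q n\<rangle> = Some (S n)" "\<And>n. solves f (X n) (S n)"
    by metis
  from Hy[OF q] obtain s where s: "H \<langle>x, q\<rangle> = Some s" "solves f x s"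
    by metis
  have "(\<lambda>n. \<langle>(X \<circ> r) n, (Q \<circ> r) n\<rangle>) \<longlonglongrightarrow> \<langle>x, q\<rangle>"
    using LIMSEQ_subseq_LIMSEQ[OF X(1) r] lim by (rule tendsto_pair_baire)
  with H have "(\<lambda>n. S (r n)) \<longlonglongrightarrow> s"
    by (rule partial_continuous_tendsto) (simp_all add: s(1) S(1))
  then have "\<forall>\<^sub>F n in sequentially. S (r n) 0 = s 0"
    by (simp add: tendsto_baire_iff)
  then obtain n where "S (r n) 0 = s 0"
    by (auto simp: eventually_sequentially)
  with jump(1)[OF S(2)] jump(2)[OF s(2)] show False
    by simp
qed

text \<open>The zeros are placed in component 0 of the parallelization, so that one sequence serves
  for both LPO and its parallelization.\<close>

lemma single_zero_tendsto_ones: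
  "(\<lambda>n. (\<lambda>_. 1)(prod_encode (0, n) := 0)) \<longlonglongrightarrow> ((\<lambda>_. 1) :: baire)"
  by (rule tendsto_fun_upd) (simp add: inj_def)

lemma LPO_not_reducible_to_compactly_solvable:
  assumes "ran (tgt_rep g) = UNIV" "compactly_solvable g"
  shows "\<not> reducible_via partial_continuous LPO g"
  using assms single_zero_tendsto_ones
proof (rule discontinuous_not_reducible_to_compactly_solvable)
  fix n s
  assume "solves LPO ((\<lambda>_. 1)(prod_encode (0, n) := 0)) s"
  then show "s 0 = 0"
    by (simp add: solves_LPO vals_LPO_zero[of _ "prod_encode (0, n)"])
qed (simp_all add: is_instance_LPO solves_LPO vals_LPO)

lemma parallelization_LPO_not_reducible_to_compactly_solvable:
  assumes "ran (tgt_rep g) = UNIV" "compactly_solvable g"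
  shows "\<not> reducible_via partial_continuous (parallelization LPO) g"
  using assms single_zero_tendsto_ones
proof (rule discontinuous_not_reducible_to_compactly_solvable)
  fix n s
  assume "solves (parallelization LPO) ((\<lambda>_. 1)(prod_encode (0, n) := 0)) s"
  then have "s 0 \<in> vals LPO (component ((\<lambda>_. 1)(prod_encode (0, n) := 0)) 0)"
    by (simp add: solves_parallelization)
  moreover have "component ((\<lambda>_. 1)(prod_encode (0, n) := 0)) 0 n = 0"
    by (simp add: component_def)
  ultimately show "s 0 = 0"
    using vals_LPO_zero by blast
qed (auto simp: is_instance_parallelization mdom_LPO solves_parallelization vals_LPO component_def)

section \<open>The parallelization of LLPO does not reduce to LPO\<close>

text \<open>Inserting a spike in a zero component \<open>j\<close> at a place of parity \<open>b\<close> forces the answer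
  \<open>1 - b\<close> there.\<close>

definition spike :: "baire \<Rightarrow> nat \<Rightarrow> nat \<Rightarrow> nat \<Rightarrow> baire" where
  "spike x j b n = x(prod_encode (j, 2 * n + b) := 1)"

lemma spike_tendsto: "spike x j b \<longlonglongrightarrow> x"
  unfolding spike_def by (rule tendsto_fun_upd) (simp add: inj_def)

lemma component_spike:
  "component (spike x j b n) k = (if k = j then (component x j)(2 * n + b := 1) else component x k)"
  by (auto simp: component_def spike_def fun_eq_iff)

lemma vals_LLPO_spike:
  assumes "b \<in> {0, 1}"
  shows "vals LLPO ((\<lambda>_. 0)(2 * n + b := 1)) = {1 - b}"
proof (cases "b = 0")
  case True
  have "\<And>m. 2 * m + 1 \<noteq> 2 * n" by presburger
  with True show ?thesis unfolding LLPO_def problem.simps by (auto split: if_splits)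
next
  case False
  then have b: "b = 1" using assms by simp
  have "\<And>m. 2 * m \<noteq> Suc (2 * n)" by presburger
  with b show ?thesis unfolding LLPO_def problem.simps by (auto split: if_splits)
qed

lemma is_instance_spike:
  assumes "is_instance (parallelization LLPO) x" "component x j = (\<lambda>_. 0)"
  shows "is_instance (parallelization LLPO) (spike x j b n)"
  using assms by (auto simp: is_instance_parallelization component_spike mdom_LLPO split: if_splits)

lemma solves_spike:
  assumes "b \<in> {0, 1}" "component x j = (\<lambda>_. 0)"
    and "solves (parallelization LLPO) (spike x j b n) s"
  shows "s j = 1 - b"
proof -
  have "s j \<in> vals LLPO (component (spike x j b n) j)"
    using assms(3) by (simp add: solves_parallelization)
  then show ?thesis
    using assms(2) vals_LLPO_spike[OF assms(1), of n] by (simp add: component_spike)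
qed

text \<open>The value \<open>s j\<close> at \<open>x\<close> would have to be the limit of the forced answers both for even
  and for odd spikes. The second argument \<open>q\<close> of \<open>H\<close> stands for an answer of LPO that
  is the same for all spikes.\<close>

lemma no_continuous_solution_near_zero_component:
  assumes "partial_continuous H" and j: "component x j = (\<lambda>_. 0)"
    and s: "H \<langle>x, q\<rangle> = Some s"
    and near: "\<And>b. b \<in> {0, 1} \<Longrightarrow> \<forall>\<^sub>F n in sequentially.
      \<exists>t. H \<langle>spike x j b n, q\<rangle> = Some t \<and> solves (parallelization LLPO) (spike x j b n) t"
  shows False
proof -
  have "s j = 1 - b" if b: "b \<in> {0, 1}" for b
  proof -
    define T where "T n = the (H \<langle>spike x j b n, q\<rangle>)" for n
    have T: "\<forall>\<^sub>F n in sequentially. H \<langle>spike x j b n, q\<rangle> = Some (T n) \<and>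
        solves (parallelization LLPO) (spike x j b n) (T n)"
      using near[OF b] by eventually_elim (auto simp: T_def)
    have "(\<lambda>n. \<langle>spike x j b n, q\<rangle>) \<longlonglongrightarrow> \<langle>x, q\<rangle>"
      by (rule tendsto_pair_baire[OF spike_tendsto[of x j b] tendsto_const[of q]])
    with assms(1) have "T \<longlonglongrightarrow> s"
      by (rule partial_continuous_tendsto) (rule s, use T in \<open>eventually_elim, simp\<close>)
    then have "\<forall>\<^sub>F n in sequentially. T n j = s j"
      by (simp add: tendsto_baire_iff)
    with T have "\<forall>\<^sub>F n in sequentially. s j = 1 - b"
      by eventually_elim (metis solves_spike[OF b j])
    then show ?thesis
      by simp
  qed
  from this[of 0] this[of 1] show False
    by simp
qed

text \<open>LPO contributes one bit, and this bit is constant on all instances with a zero component;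
  hence it cannot repair the discontinuity at such instances.\<close>

lemma parallelization_LLPO_not_reducible_to_LPO:
  "\<not> reducible_via partial_continuous (parallelization LLPO) LPO"
proof
  let ?P = "parallelization LLPO"
  assume "reducible_via partial_continuous ?P LPO"
  then obtain H K where H: "partial_continuous H" and K: "partial_continuous K"
    and red: "\<And>p. is_instance ?P p \<Longrightarrow>
        (\<exists>k. K p = Some k \<and> is_instance LPO k \<and>
          (\<forall>q. solves LPO k q \<longrightarrow> (\<exists>s. H \<langle>p, q\<rangle> = Some s \<and> solves ?P p s)))"
    unfolding reducible_via_iff_solves[OF ran_tgt_rep(1)] by blast
  define \<kappa> where "\<kappa> p = the (K p)" for p
  have \<kappa>: "K p = Some (\<kappa> p)" if "is_instance ?P p" for p
    using red[OF that] by (auto simp: \<kappa>_def)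
  have sol: "\<exists>s. H \<langle>p, \<lambda>_. i\<rangle> = Some s \<and> solves ?P p s"
    if "is_instance ?P p" "i \<in> vals LPO (\<kappa> p)" for p i
    using red[OF that(1)] that(2) \<kappa>[OF that(1)] by (auto simp: solves_LPO)
  \<comment> \<open>A zero of \<open>\<kappa> x\<close> is an open event, so it would fix the answer 0 of LPO around \<open>x\<close>.\<close>
  have no_zero: "\<kappa> x m \<noteq> 0" if x: "is_instance ?P x" and j: "component x j = (\<lambda>_. 0)" for x j m
  proof
    assume m: "\<kappa> x m = 0"
    then obtain s where s: "H \<langle>x, \<lambda>_. 0\<rangle> = Some s"
      using sol[OF x, of 0] by (auto simp: vals_LPO_zero)
    show False
    proof (rule no_continuous_solution_near_zero_component[OF H j s])
      fix b
      have "(\<lambda>n. \<kappa> (spike x j b n)) \<longlonglongrightarrow> \<kappa> x"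
        using K spike_tendsto[of x j b]
        by (rule partial_continuous_tendsto) (simp_all add: \<kappa> x is_instance_spike[OF x j])
      then have "\<forall>\<^sub>F n in sequentially. \<kappa> (spike x j b n) m = \<kappa> x m"
        by (simp add: tendsto_baire_iff)
      then show "\<forall>\<^sub>F n in sequentially.
          \<exists>t. H \<langle>spike x j b n, \<lambda>_. 0\<rangle> = Some t \<and> solves ?P (spike x j b n) t"
      proof eventually_elim
        case (elim n)
        with m show ?case
          using sol[OF is_instance_spike[OF x j, of b n], of 0] by (simp add: vals_LPO_zero)
      qed
    qed
  qed
  define z :: baire where "z = (\<lambda>_. 0)"
  have z: "is_instance ?P z" "component z k = (\<lambda>_. 0)" for k
    by (auto simp: z_def is_instance_parallelization mdom_LLPO component_def)
  obtain s where s: "H \<langle>z, \<lambda>_. 1\<rangle> = Some s"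
    using sol[OF z(1), of 1] no_zero[OF z] by (auto simp: vals_LPO_nonzero)
  show False
  proof (rule no_continuous_solution_near_zero_component[OF H z(2)[of 0] s])
    fix b
    have "\<exists>t. H \<langle>spike z 0 b n, \<lambda>_. 1\<rangle> = Some t \<and> solves ?P (spike z 0 b n) t" for n
    proof -
      have inst: "is_instance ?P (spike z 0 b n)"
        by (rule is_instance_spike[OF z])
      \<comment> \<open>Component 1 is left untouched by the spikes, which makes \<open>no_zero\<close> applicable.\<close>
      have "component (spike z 0 b n) 1 = (\<lambda>_. 0)"
        using z(2) by (simp add: component_spike)
      from no_zero[OF inst this] show ?thesis
        using sol[OF inst, of 1] by (simp add: vals_LPO_nonzero)
    qed
    then show "\<forall>\<^sub>F n in sequentially.
        \<exists>t. H \<langle>spike z 0 b n, \<lambda>_. 1\<rangle> = Some t \<and> solves ?P (spike z 0 b n) t"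
      by simp
  qed
qed

section \<open>Programs for the positive reductions\<close>

lemma computes_Comp1:
  assumes "computes p g xs v" "computes p f [v] y"
  shows "computes p (Comp f [g]) xs y"
  using assms by (intro computes.Comp[where vs = "[v]"]) simp_all

lemma computes_Comp2:
  assumes "computes p g xs v" "computes p h xs w" "computes p f [v, w] y"
  shows "computes p (Comp f [g, h]) xs y"
  using assms by (intro computes.Comp[where vs = "[v, w]"]) simp_all

lemma computes_Proj_0: "computes p (Proj 0) (x # xs) x"
  using computes.Proj[of 0 "x # xs" p] by simp

lemma computes_Proj_1: "computes p (Proj 1) (x # y # xs) y"
  using computes.Proj[of 1 "x # y # xs" p] by simp

definition recf_add :: recf where
  "recf_add = PrimRec (Proj 0) (Comp Succ [Proj 1])"

lemma computes_recf_add: "computes p recf_add [x, y] (x + y)"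
proof (induction x)
  case 0
  show ?case
    unfolding recf_add_def by (simp add: computes.PrimRec_0 computes.Zero computes_Proj_0)
next
  case (Suc x)
  then show ?case
    unfolding recf_add_def add_Suc
    by (rule computes.PrimRec_Suc) (rule computes_Comp1[OF computes_Proj_1 computes.Succ])
qed

definition recf_pred :: recf where
  "recf_pred = PrimRec Zero (Proj 0)"

lemma computes_recf_pred: "computes p recf_pred [x] (x - 1)"
proof (induction x)
  case 0
  show ?case
    unfolding recf_pred_def by (simp add: computes.PrimRec_0 computes.Zero computes_Proj_0)
next
  case (Suc x)
  then show ?case
    unfolding recf_pred_def diff_Suc_1
    by (rule computes.PrimRec_Suc) (rule computes_Proj_0)
qed

text \<open>Primitive recursion is on the first argument, so this is the number to be subtracted.\<close>

definition recf_subtract_from :: recf where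
  "recf_subtract_from = PrimRec (Proj 0) (Comp recf_pred [Proj 1])"

lemma computes_recf_subtract_from: "computes p recf_subtract_from [x, y] (y - x)"
proof (induction x)
  case 0
  show ?case
    unfolding recf_subtract_from_def by (simp add: computes.PrimRec_0 computes.Zero computes_Proj_0)
next
  case (Suc x)
  have "computes p (Comp recf_pred [Proj 1]) [x, y - x, y] (y - x - 1)"
    by (rule computes_Comp1[OF computes_Proj_1 computes_recf_pred])
  with Suc have "computes p recf_subtract_from [Suc x, y] (y - x - 1)"
    unfolding recf_subtract_from_def by (rule computes.PrimRec_Suc)
  then show ?case
    by simp
qed

definition recf_triangle :: recf where
  "recf_triangle = PrimRec Zero (Comp Succ [Comp recf_add [Proj 0, Proj 1]])"

lemma computes_recf_triangle: "computes p recf_triangle [x] (triangle x)"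
proof (induction x)
  case 0
  show ?case
    unfolding recf_triangle_def by (simp add: computes.PrimRec_0 computes.Zero computes_Proj_0)
next
  case (Suc x)
  have "computes p (Comp Succ [Comp recf_add [Proj 0, Proj 1]]) [x, triangle x] (Suc (x + triangle x))"
    by (rule computes_Comp1 computes_Comp2 computes_recf_add computes.Succ
        computes_Proj_0 computes_Proj_1)+
  with Suc have "computes p recf_triangle [Suc x] (Suc (x + triangle x))"
    unfolding recf_triangle_def by (rule computes.PrimRec_Suc)
  then show ?case
    by (simp add: add.commute)
qed

definition recf_double :: recf where
  "recf_double = Comp recf_add [Proj 0, Proj 0]"

lemma computes_recf_double: "computes p recf_double [n] (2 * n)"
  unfolding recf_double_def mult_2
  by (rule computes_Comp2[OF computes_Proj_0 computes_Proj_0 computes_recf_add])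

text \<open>The pairing enumerates the diagonals \<open>k + n = d\<close> one after the other, and diagonal \<open>d\<close>
  starts at \<^term>\<open>triangle d\<close>. So the diagonal of \<open>z\<close> is the least \<open>d\<close> with
  \<open>z < triangle (d + 1)\<close>, and the column \<open>k\<close> is the distance of \<open>z\<close> from the start of the
  diagonal.\<close>

definition recf_diagonal :: recf where
  "recf_diagonal =
     Mu (Comp recf_subtract_from
          [Comp recf_triangle [Comp Succ [Proj 0]], Comp Succ [Proj 1]])"

lemma triangle_mono: "m \<le> n \<Longrightarrow> triangle m \<le> triangle n"
  by (rule lift_Suc_mono_le[of triangle]) auto

lemma computes_recf_diagonal: "computes p recf_diagonal [prod_encode (k, n)] (k + n)"
proof -
  have test: "computes p (Comp recf_subtract_from
          [Comp recf_triangle [Comp Succ [Proj 0]], Comp Succ [Proj 1]])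
        [m, z] (Suc z - triangle (Suc m))" for m z
    by (rule computes_Comp1 computes_Comp2 computes_recf_subtract_from computes_recf_triangle
        computes.Succ computes_Proj_0 computes_Proj_1)+
  have "Suc (prod_encode (k, n)) - triangle (Suc (k + n)) = 0"
    by (simp add: prod_encode_def)
  moreover have "Suc (prod_encode (k, n)) - triangle (Suc m) \<noteq> 0" if "m < k + n" for m
    using triangle_mono[of "Suc m" "k + n"] that by (simp add: prod_encode_def)
  ultimately show ?thesis
    unfolding recf_diagonal_def using test by (metis computes.Mu)
qed

definition recf_column :: recf where
  "recf_column = Comp recf_subtract_from [Comp recf_triangle [recf_diagonal], Proj 0]"

lemma computes_recf_column: "computes p recf_column [prod_encode (k, n)] k"
proof -
  have "computes p recf_column [prod_encode (k, n)] (prod_encode (k, n) - triangle (k + n))"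
    unfolding recf_column_def
    by (rule computes_Comp1 computes_Comp2 computes_recf_subtract_from computes_recf_triangle
        computes_recf_diagonal computes_Proj_0)+
  then show ?thesis
    by (simp add: prod_encode_def)
qed

text \<open>In terms of the diagonal \<open>d = k + n\<close>, the pair \<open>(k, 2 * n)\<close> lies on the diagonal
  \<open>2 * d - k\<close>; this avoids decoding \<open>n\<close>.\<close>

definition recf_double_index :: recf where
  "recf_double_index =
     Comp recf_add
       [Comp recf_triangle
          [Comp recf_subtract_from [recf_column, Comp recf_double [recf_diagonal]]],
        recf_column]"

lemma computes_recf_double_index:
  "computes p recf_double_index [prod_encode (k, n)] (prod_encode (k, 2 * n))"
proof -
  have "computes p recf_double_index [prod_encode (k, n)] (triangle (2 * (k + n) - k) + k)"
    unfolding recf_double_index_def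
    by (rule computes_Comp1 computes_Comp2 computes_recf_add computes_recf_subtract_from
        computes_recf_triangle computes_recf_double computes_recf_diagonal computes_recf_column)+
  moreover have "2 * (k + n) - k = k + 2 * n"
    by simp
  ultimately show ?thesis
    by (simp add: prod_encode_def)
qed

text \<open>Both reduction functions, inward and outward, are negations of a single query
  at a computable position.\<close>

definition recf_negated_query :: "recf \<Rightarrow> recf" where
  "recf_negated_query h = Comp recf_subtract_from [Comp Oracle [h], Comp Succ [Zero]]"

lemma computes_recf_negated_query:
  assumes "computes p h xs m"
  shows "computes p (recf_negated_query h) xs (1 - p m)"
  unfolding recf_negated_query_def One_nat_def
  by (rule computes_Comp1 computes_Comp2 assms computes.Oracle computes.Zero computes.Succ
      computes_recf_subtract_from)+

lemma computable_negated_query: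
  assumes "\<And>p n. computes p h [n] (c n)"
  shows "computable (\<lambda>p. Some (\<lambda>n. 1 - p (c n)))"
  unfolding computable_def
  by (rule exI[of _ "recf_negated_query h"]) (use computes_recf_negated_query assms in blast)

section \<open>LLPO reduces to LPO\<close>

text \<open>If LPO finds a nonzero even digit, then this is the only nonzero digit, so the odd digits
  vanish; otherwise the even digits vanish.\<close>

lemma LLPO_from_LPO_of_even_digits:
  assumes "x \<in> mdom LLPO" and "v \<in> vals LPO (\<lambda>n. 1 - x (2 * n))"
  shows "1 - v \<in> vals LLPO x"
proof (cases "\<forall>n. x (2 * n) = 0")
  case True
  then have "v = 1"
    using assms(2) by (simp add: vals_LPO)
  with assms(1) True show ?thesis
    by (simp add: in_vals_LLPO_iff)
next
  case False
  then obtain n where n: "x (2 * n) \<noteq> 0"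
    by blast
  then have "1 - x (2 * n) = 0"
    by simp
  then have "vals LPO (\<lambda>n. 1 - x (2 * n)) = {0}"
    by (rule vals_LPO_zero)
  with assms(2) have "v = 0"
    by simp
  have "x (2 * m + 1) = 0" for m
  proof (rule ccontr)
    assume "x (2 * m + 1) \<noteq> 0"
    with n assms(1) have "2 * n = 2 * m + 1"
      unfolding mdom_LLPO by blast
    then show False
      by presburger
  qed
  with \<open>v = 0\<close> assms(1) show ?thesis
    by (simp add: in_vals_LLPO_iff)
qed

lemma pair_baire_odd: "\<langle>p, q\<rangle> (Suc (2 * n)) = q n"
  by (simp add: pair_baire_def)

text \<open>The outer function of both reductions: the odd digits of \<open>\<langle>p, q\<rangle>\<close> are those of \<open>q\<close>, so this
  negates the answer digitwise.\<close>

lemma computable_negate_answer: "computable (\<lambda>r. Some (\<lambda>n. 1 - r (2 * n + 1)))"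
  by (rule computable_negated_query[of "Comp Succ [recf_double]"])
    (simp, rule computes_Comp1, rule computes_recf_double, rule computes.Succ)

lemma LLPO_le_LPO: "LLPO \<le>\<^sub>W LPO"
  unfolding weihrauch_le_def reducible_via_iff_solves[OF ran_tgt_rep(1)]
proof (intro exI conjI allI impI)
  show "computable (\<lambda>r. Some (\<lambda>n. 1 - r (2 * n + 1)))"
    by (rule computable_negate_answer)
  show "computable (\<lambda>p. Some (\<lambda>n. 1 - p (2 * n)))"
    by (rule computable_negated_query[OF computes_recf_double])
next
  fix p q
  assume "is_instance LLPO p" "solves LPO (\<lambda>n. 1 - p (2 * n)) q"
  then show "solves LLPO p (\<lambda>n. 1 - q n)"
    unfolding solves_LLPO solves_LPO is_instance_LLPO by (rule LLPO_from_LPO_of_even_digits)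
qed (auto simp: is_instance_LPO pair_baire_odd)

lemma parallelization_LLPO_le_parallelization_LPO:
  "parallelization LLPO \<le>\<^sub>W parallelization LPO"
proof -
  define c where "c z = (case prod_decode z of (k, n) \<Rightarrow> prod_encode (k, 2 * n))" for z
  have comp: "component (\<lambda>z. 1 - p (c z)) k = (\<lambda>n. 1 - component p k (2 * n))" for p k
    by (simp add: component_def c_def)
  show ?thesis
    unfolding weihrauch_le_def reducible_via_iff_solves[OF ran_tgt_rep(3)]
  proof (intro exI conjI allI impI)
    show "computable (\<lambda>r. Some (\<lambda>n. 1 - r (2 * n + 1)))"
      by (rule computable_negate_answer)
    have "computes p recf_double_index [z] (c z)" for p z
      using computes_recf_double_index[of p "fst (prod_decode z)" "snd (prod_decode z)"]
      by (simp add: c_def case_prod_beta)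
    then show "computable (\<lambda>p. Some (\<lambda>z. 1 - p (c z)))"
      by (rule computable_negated_query)
  next
    fix p q
    assume "is_instance (parallelization LLPO) p"
      "solves (parallelization LPO) (\<lambda>z. 1 - p (c z)) q"
    then show "solves (parallelization LLPO) p (\<lambda>n. 1 - q n)"
      unfolding solves_parallelization is_instance_parallelization comp
      using LLPO_from_LPO_of_even_digits by blast
  qed (auto simp: is_instance_parallelization mdom_LPO pair_baire_odd)
qed

theorem theorem7p13:
  "LLPO <\<^sub>W LPO \<and>
   LPO \<bar>\<^sub>W parallelization LLPO \<and>
   parallelization LLPO <\<^sub>W parallelization LPO \<and>
   (\<forall>\<C> \<in> {oracle_computable, partial_continuous}.
      \<not> reducible_via \<C> LPO LLPO \<and>
      \<not> reducible_via \<C> LPO (parallelization LLPO) \<and>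
      \<not> reducible_via \<C> (parallelization LLPO) LPO \<and>
      \<not> reducible_via \<C> (parallelization LPO) (parallelization LLPO))"
proof -
  note not_continuously =
    LPO_not_reducible_to_compactly_solvable[OF ran_tgt_rep(2) compactly_solvable_LLPO]
    LPO_not_reducible_to_compactly_solvable
      [OF ran_tgt_rep(3) compactly_solvable_parallelization_LLPO]
    parallelization_LLPO_not_reducible_to_LPO
    parallelization_LPO_not_reducible_to_compactly_solvable
      [OF ran_tgt_rep(3) compactly_solvable_parallelization_LLPO]
  have neg: "\<not> reducible_via \<C> LPO LLPO \<and>
      \<not> reducible_via \<C> LPO (parallelization LLPO) \<and>
      \<not> reducible_via \<C> (parallelization LLPO) LPO \<and>
      \<not> reducible_via \<C> (parallelization LPO) (parallelization LLPO)"
    if "\<And>F. \<C> F \<Longrightarrow> partial_continuous F" for \<C>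
    using not_continuously by (auto dest: reducible_via_mono[where \<D> = partial_continuous, OF _ that])
  show ?thesis
    unfolding weihrauch_less_def weihrauch_incomparable_def
    using LLPO_le_LPO parallelization_LLPO_le_parallelization_LPO
      neg[OF computable_imp_partial_continuous]
      neg[OF oracle_computable_imp_partial_continuous] neg[of partial_continuous]
    by (auto simp: weihrauch_le_def)
qed

end
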